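(* Let $(X,\mathsf{d})$ be a geodesic metric space which admits a weight measure $\mu_{\mathrm{w}}$ (a positive Radon measure), and assume that $\mu_{\mathrm{w}}$ puts no mass on non-proper chains and that the total volume $\mu_{\mathrm{w}}(X)$ is finite. Then, for each $N\in\mathbb{Z}_{>0}$, $$\mathrm{Mag}(X,\mathsf{d},\mu_{\mathrm{w}},\Gamma^{\mathrm{triv}};N)=\begin{cases}\mu_{\mathrm{w}}(X)&\text{if } N \text{ is even},\\ 0&\text{if } N\text{ is odd}.\end{cases}$$ In particular, $\lim_{N\to\infty}\mathrm{Mag}(X,\mathsf{d},\mu_{\mathrm{w}},\Gamma^{\mathrm{triv}};2N)=\mu_{\mathrm{w}}(X)$.
   Context: A geodesic metric space is a metric space in which any two points are joined by a path whose length equals their distance. A weight measure on $(X,\mathsf{d})$ is a Borel measure $\mu_{\mathrm{w}}$ with $\int_{x\in X}e^{-\mathsf{d}(x,y)}\,\mathrm{d}\mu_{\mathrm{w}}(x)=1$ for every $y\in X$; only positive Radon measures are considered. For $n\ge 1$, $P_n(X):=\{(x_0,\dots,x_n)\in X^{n+1}\mid x_{k-1}\ne x_k \text{ for } k=1,\dots,n\}$. A Borel measure $\mu$ puts no mass on non-proper chains if $\mu^{n+1}(X^{n+1}\setminus P_n(X))=0$ for all $n\in\mathbb{Z}_{>0}$, where $\mu^{n+1}$ is the product measure. Let $\Omega_{x,y}$ be the set of non-constant length-minimising geodesics from $x$ to $y$ (empty if $x=y$). $\Gamma^{\mathrm{triv}}_{x,y}$ is the measure on $\{\emptyset,\Omega_{x,y}\}$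 with $\Gamma^{\mathrm{triv}}_{x,y}(\Omega_{x,y})=1$ if $\Omega_{x,y}\neq\emptyset$. For $\bm{x}\in P_n(X)$, $\Omega_{\bm{x}}=\prod_{k=1}^n\Omega_{x_{k-1},x_k}$ carries the product measure $\Gamma^{\mathrm{triv}}_{\bm{x}}$, and $\mathrm{Len}(\gamma)=\sum_{k=1}^n\mathsf{d}(x_{k-1},x_k)$ for $\gamma\in\Omega_{\bm{x}}$. For $\mu(X)<\infty$, $$\mathrm{Mag}(X,\mathsf{d},\mu,\Gamma^{\mathrm{triv}};N):=\mu(X)+\sum_{n=1}^N(-1)^n\int_{P_n(X)}\Big(\int_{\Omega_{\bm{x}}}e^{-\mathrm{Len}(\gamma)}\,\mathrm{d}\Gamma^{\mathrm{triv}}_{\bm{x}}\Big)\mathrm{d}\mu^{n+1}.$$ *)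

theory Defs
  imports "HOL-Analysis.Analysis"
begin

text \<open>The metric space \<open>(X, d)\<close> is a type of class \<^class>\<open>metric_space\<close> with \<^const>\<open>dist\<close>. As in the
  library, paths are parametrised by \<open>[0,1]\<close>; their values outside this interval are irrelevant.\<close>

definition path_length :: "(real \<Rightarrow> 'a::metric_space) \<Rightarrow> ennreal" where
  "path_length \<gamma> = (SUP ts \<in> {ts. sorted ts \<and> set ts \<subseteq> {0..1}}.
     \<Sum>i<length ts - 1. ennreal (dist (\<gamma> (ts ! i)) (\<gamma> (ts ! Suc i))))"

definition minimising_path :: "'a::metric_space \<Rightarrow> 'a \<Rightarrow> (real \<Rightarrow> 'a) \<Rightarrow> bool" where
  "minimising_path x y \<gamma> \<longleftrightarrow> path \<gamma> \<and> pathstart \<gamma> = x \<and> pathfinish \<gamma> = y \<and>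
     path_length \<gamma> = ennreal (dist x y)"

definition geodesic_space :: "'a::metric_space itself \<Rightarrow> bool" where
  "geodesic_space _ \<longleftrightarrow> (\<forall>x y :: 'a. \<exists>\<gamma>. minimising_path x y \<gamma>)"

definition radon_measure :: "'a::metric_space measure \<Rightarrow> bool" where
  "radon_measure \<mu> \<longleftrightarrow> sets \<mu> = sets borel \<and>
     (\<forall>x. \<exists>U. open U \<and> x \<in> U \<and> emeasure \<mu> U < \<infinity>) \<and>
     (\<forall>A \<in> sets \<mu>. emeasure \<mu> A = (SUP K \<in> {K. compact K \<and> K \<subseteq> A}. emeasure \<mu> K))"

definition weight_measure :: "'a::metric_space measure \<Rightarrow> bool" where
  "weight_measure \<mu> \<longleftrightarrow> sets \<mu> = sets borel \<and>
     (\<forall>y. (\<integral>\<^sup>+ x. ennreal (exp (- dist x y)) \<partial>\<mu>) = 1)"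

text \<open>The product measure \<open>\<mu>\<close>\<open>\<^sup>n\<^sup>+\<^sup>1\<close> on \<open>X\<close>\<open>\<^sup>n\<^sup>+\<^sup>1\<close>. It is completed because, if \<open>X\<close> is not separable, the diagonal
  and the distance need not be measurable for the product of the Borel sigma-algebras. For a finite
  Radon measure, which is concentrated on a sigma-compact set, the completed product sigma-algebra
  contains all Borel sets of the product space.\<close>

definition chain_measure :: "nat \<Rightarrow> 'a measure \<Rightarrow> (nat \<Rightarrow> 'a) measure" where
  "chain_measure n \<mu> = completion (Pi\<^sub>M {..n} (\<lambda>_. \<mu>))"

definition proper_chains :: "nat \<Rightarrow> (nat \<Rightarrow> 'a) set" where
  "proper_chains n = {x \<in> {..n} \<rightarrow>\<^sub>E UNIV. \<forall>k\<in>{1..n}. x (k - 1) \<noteq> x k}"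

definition no_mass_on_nonproper_chains :: "'a measure \<Rightarrow> bool" where
  "no_mass_on_nonproper_chains \<mu> \<longleftrightarrow>
     (\<forall>n>0. ({..n} \<rightarrow>\<^sub>E UNIV) - proper_chains n \<in> null_sets (chain_measure n \<mu>))"

definition geodesics :: "'a::metric_space \<Rightarrow> 'a \<Rightarrow> (real \<Rightarrow> 'a) set" where
  "geodesics x y = {\<gamma>. minimising_path x y \<gamma> \<and> \<not> \<gamma> constant_on {0..1}}"

definition \<Gamma>_triv :: "'a::metric_space \<Rightarrow> 'a \<Rightarrow> (real \<Rightarrow> 'a) measure" where
  "\<Gamma>_triv x y = measure_of (geodesics x y) {{}, geodesics x y} (\<lambda>A. if A = {} then 0 else 1)"

text \<open>The product of the measures \<open>\<Gamma>\<close> along a chain; for \<open>\<Gamma>_triv\<close> its underlying space is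
  the set of broken geodesics along the chain.\<close>

definition chain_path_measure ::
    "('a \<Rightarrow> 'a \<Rightarrow> (real \<Rightarrow> 'a) measure) \<Rightarrow> nat \<Rightarrow> (nat \<Rightarrow> 'a) \<Rightarrow> (nat \<Rightarrow> real \<Rightarrow> 'a) measure" where
  "chain_path_measure \<Gamma> n x = Pi\<^sub>M {1..n} (\<lambda>k. \<Gamma> (x (k - 1)) (x k))"

text \<open>The length depends on a broken geodesic \<open>\<gamma>\<close> only through the chain \<open>x\<close> of its break points.\<close>

definition Len :: "nat \<Rightarrow> (nat \<Rightarrow> 'a::metric_space) \<Rightarrow> (nat \<Rightarrow> real \<Rightarrow> 'a) \<Rightarrow> real" where
  "Len n x \<gamma> = (\<Sum>k=1..n. dist (x (k - 1)) (x k))"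

definition Mag :: "'a::metric_space measure \<Rightarrow> ('a \<Rightarrow> 'a \<Rightarrow> (real \<Rightarrow> 'a) measure) \<Rightarrow> nat \<Rightarrow> real" where
  "Mag \<mu> \<Gamma> N = measure \<mu> (space \<mu>) +
     (\<Sum>n=1..N. (-1) ^ n *
        (LINT x:proper_chains n|chain_measure n \<mu>.
           (LINT \<gamma>|chain_path_measure \<Gamma> n x. exp (- Len n x \<gamma>))))"

lemma geodesics_refl: "geodesics x x = {}"
proof -
  have "\<gamma> constant_on {0..1}" if \<gamma>: "minimising_path x x \<gamma>" for \<gamma> :: "real \<Rightarrow> 'a"
  proof -
    have "\<gamma> t = \<gamma> 0" if t: "t \<in> {0..1}" for t
    proof -
      have "(\<Sum>i<length [0,t] - 1. ennreal (dist (\<gamma> ([0,t] ! i)) (\<gamma> ([0,t] ! Suc i)))) \<le> path_length \<gamma>"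
        unfolding path_length_def using t by (intro SUP_upper) auto
      then show ?thesis
        using \<gamma> by (simp add: minimising_path_def dist_commute)
    qed
    then show ?thesis
      unfolding constant_on_def by blast
  qed
  then show ?thesis
    by (auto simp: geodesics_def)
qed

lemma space_\<Gamma>_triv: "space (\<Gamma>_triv x y) = geodesics x y"
  and sets_\<Gamma>_triv: "sets (\<Gamma>_triv x y) = {{}, geodesics x y}"
  by (auto simp: \<Gamma>_triv_def space_measure_of_conv sets_measure_of_conv
      sigma_algebra.sigma_sets_eq[OF sigma_algebra_trivial])

lemma emeasure_\<Gamma>_triv:
  assumes "geodesics x y \<noteq> {}"
  shows "emeasure (\<Gamma>_triv x y) (geodesics x y) = 1"
proof (subst emeasure_measure_of[OF \<Gamma>_triv_def])
  let ?m = "\<lambda>A :: (real \<Rightarrow> 'a) set. if A = {} then 0 else 1 :: ennreal"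
  show "positive (sets (\<Gamma>_triv x y)) ?m"
    by (simp add: positive_def)
  show "countably_additive (sets (\<Gamma>_triv x y)) ?m"
  proof (rule countably_additiveI)
    fix A :: "nat \<Rightarrow> (real \<Rightarrow> 'a) set"
    assume A: "range A \<subseteq> sets (\<Gamma>_triv x y)" "disjoint_family A"
    show "(\<Sum>i. ?m (A i)) = ?m (\<Union>i. A i)"
    proof (cases "\<exists>j. A j \<noteq> {}")
      case True
      then obtain j where j: "A j \<noteq> {}" by blast
      have "A i = {}" if "i \<noteq> j" for i
      proof -
        have "A i \<in> {{}, geodesics x y}" "A j = geodesics x y"
          using A(1) j unfolding sets_\<Gamma>_triv by auto
        moreover have "A i \<inter> A j = {}"
          using A(2) that by (auto simp: disjoint_family_on_def)
        ultimately show ?thesis by auto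
      qed
      then have "(\<Sum>i. ?m (A i)) = (\<Sum>i\<in>{j}. ?m (A i))"
        by (intro suminf_finite) auto
      then show ?thesis using j by auto
    qed auto
  qed
qed (use assms in \<open>auto simp: sets_\<Gamma>_triv\<close>)

end

theory Submission
  imports Defs "HOL-Probability.Infinite_Product_Measure"
begin

text \<open>For \<open>\<Gamma>_triv\<close> the inner integral over a proper chain is \<open>exp (- \<Sum> d (x\<^sub>k\<^sub>-\<^sub>1, x\<^sub>k))\<close>, since distinct points
  are joined by a non-constant geodesic. Integrating out the last point of a chain with the weight
  equation removes one factor, so every term of the magnitude has absolute value \<open>\<mu>(X)\<close>, and the
  alternating sum telescopes.

  The integrand need not be measurable for the product sigma-algebra. But a finite Radon measure is
  concentrated on a countable union of compact sets, hence on the closure of a countable set \<open>D\<close>;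
  there \<open>exp (- d (x, y))\<close> is the supremum of \<open>exp (- (d (x, q) + d (q, y)))\<close> over \<open>q \<in> D\<close>, which is
  jointly measurable.\<close>

section \<open>Concentration of a finite Radon measure on a separable set\<close>

lemma compact_subset_closure_countable:
  fixes K :: "'a::metric_space set"
  assumes "compact K"
  shows "\<exists>D. countable D \<and> K \<subseteq> closure D"
proof -
  obtain k where k: "\<And>e::real. 0 < e \<Longrightarrow> finite (k e)" "\<And>e. 0 < e \<Longrightarrow> K \<subseteq> (\<Union>x\<in>k e. ball x e)"
    using assms unfolding compact_eq_totally_bounded by metis
  \<comment> \<open>Finite nets at all scales 1/(n+1). Their centres may lie outside
    \<open>K\<close>, hence the inclusion in the closure.\<close>
  let ?D = "\<Union>n. k (inverse (Suc n))"
  have "K \<subseteq> closure ?D"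
  proof
    fix x assume "x \<in> K"
    have "\<exists>y\<in>?D. dist y x < e" if "0 < e" for e
    proof -
      obtain n where n: "inverse (Suc n) < e"
        using reals_Archimedean \<open>0 < e\<close> by blast
      obtain y where "y \<in> k (inverse (Suc n))" "dist y x < inverse (Suc n)"
        using k(2)[of "inverse (Suc n)"] \<open>x \<in> K\<close> by fastforce
      then show ?thesis using n by force
    qed
    then show "x \<in> closure ?D"
      by (auto simp: closure_approachable)
  qed
  moreover have "countable ?D"
    using k(1) by (intro countable_UN) (auto simp: countable_finite)
  ultimately show ?thesis by blast
qed

text \<open>Inner regularity of the whole space gives compact sets whose measures have supremum
  \<mu>(X); their union then has full measure.\<close>

lemma radon_measure_AE_closure_countable:
  fixes \<mu> :: "'a::metric_space measure"
  assumes "radon_measure \<mu>" "finite_measure \<mu>"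
  shows "\<exists>D. countable D \<and> (AE x in \<mu>. x \<in> closure D)"
proof -
  interpret finite_measure \<mu> by fact
  have sets [measurable_cong]: "sets \<mu> = sets borel"
    using assms by (simp add: radon_measure_def)
  then have space: "space \<mu> = UNIV"
    using sets_eq_imp_space_eq[of \<mu> borel] by simp
  define A where "A = emeasure \<mu> ` {K. compact K}"
  have "emeasure \<mu> UNIV = Sup A"
    using assms sets unfolding radon_measure_def A_def by auto
  moreover have "A \<noteq> {}"
    unfolding A_def using compact_empty by blast
  ultimately obtain f where f: "range f \<subseteq> A" "emeasure \<mu> UNIV = (SUP i::nat. f i)"
    using ennreal_Sup_countable_SUP[of A] by auto
  then have "\<forall>i. \<exists>K. compact K \<and> emeasure \<mu> K = f i"
    unfolding A_def by (auto simp: image_subset_iff image_iff) metis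
  then obtain K where K: "\<And>i. compact (K i)" "\<And>i. emeasure \<mu> (K i) = f i"
    by metis
  have K_sets [measurable]: "K i \<in> sets \<mu>" for i
    using K(1) sets by (simp add: borel_compact)
  have "emeasure \<mu> UNIV \<le> emeasure \<mu> (\<Union>i. K i)"
    unfolding f(2) K(2)[symmetric] by (intro SUP_least emeasure_mono) auto
  then have eq: "emeasure \<mu> (\<Union>i. K i) = emeasure \<mu> UNIV"
    using emeasure_space[of \<mu> "\<Union>i. K i"] space by (intro antisym) auto
  \<comment> \<open>Equal measures give a null complement because \<mu>(X) is finite.\<close>
  have "UNIV - (\<Union>i. K i) \<in> null_sets \<mu>"
    using emeasure_compl[of "\<Union>i. K i" \<mu>] eq sets.compl_sets[of "\<Union>i. K i" \<mu>]
    by (intro null_setsI) (auto simp: space)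
  then have AE: "AE x in \<mu>. x \<in> (\<Union>i. K i)"
    using AE_not_in by fastforce
  obtain D where D: "\<And>i. countable (D i)" "\<And>i. K i \<subseteq> closure (D i)"
    using compact_subset_closure_countable[OF K(1)] by metis
  have "(\<Union>i. K i) \<subseteq> closure (\<Union>i. D i)"
    using D(2) closure_mono[of "D _" "\<Union>i. D i"] by blast
  then have "AE x in \<mu>. x \<in> closure (\<Union>i. D i)"
    using AE by (auto elim!: eventually_mono)
  moreover have "countable (\<Union>i. D i)"
    using D(1) by auto
  ultimately show ?thesis by blast
qed

section \<open>A jointly measurable substitute for exp(-d)\<close>

definition exp_dist_via :: "'a::metric_space set \<Rightarrow> 'a \<Rightarrow> 'a \<Rightarrow> ennreal" where
  "exp_dist_via D x y = (SUP q\<in>D. ennreal (exp (- dist x q)) * ennreal (exp (- dist q y)))"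

text \<open>A detour is never shorter, by the triangle inequality; detours through points of
  \<open>D\<close> tending to \<open>x\<close> cost arbitrarily little. The second argument is
  arbitrary.\<close>

lemma exp_dist_via_eq:
  assumes "x \<in> closure D"
  shows "exp_dist_via D x y = ennreal (exp (- dist x y))"
proof (rule antisym)
  show "exp_dist_via D x y \<le> ennreal (exp (- dist x y))"
    unfolding exp_dist_via_def
  proof (rule SUP_least)
    fix q
    have "- dist x q + - dist q y \<le> - dist x y"
      using dist_triangle[of x y q] by simp
    then show "ennreal (exp (- dist x q)) * ennreal (exp (- dist q y)) \<le> ennreal (exp (- dist x y))"
      by (simp add: ennreal_mult[symmetric] exp_add[symmetric])
  qed
  obtain q where q: "\<And>n. q n \<in> D" "q \<longlonglongrightarrow> x"
    using assms unfolding closure_sequential by blast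
  have "(\<lambda>n. ennreal (exp (- dist x (q n))) * ennreal (exp (- dist (q n) y)))
      \<longlonglongrightarrow> ennreal (exp (- dist x x)) * ennreal (exp (- dist x y))"
    unfolding ennreal_mult[OF exp_ge_zero exp_ge_zero, symmetric]
    by (intro tendsto_intros q)
  then show "ennreal (exp (- dist x y)) \<le> exp_dist_via D x y"
    unfolding exp_dist_via_def by (auto intro!: LIMSEQ_le_const2 SUP_upper q)
qed

text \<open>For fixed \<open>q\<close> each factor is a continuous function of one argument only,
  and the supremum is countable.\<close>

lemma borel_measurable_exp_dist_via:
  assumes "countable D" "f \<in> borel_measurable M" "g \<in> borel_measurable M"
  shows "(\<lambda>x. exp_dist_via D (f x) (g x)) \<in> borel_measurable M"
proof -
  have [measurable]: "(\<lambda>z. dist z q) \<in> borel_measurable borel" "dist q \<in> borel_measurable borel"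
    for q :: 'a
    by (auto intro!: borel_measurable_continuous_onI continuous_intros)
  note assms(2,3)[measurable]
  show ?thesis
    unfolding exp_dist_via_def using assms(1) by measurable
qed

section \<open>Almost-everywhere arguments for products and completions\<close>

text \<open>The exceptional points lie in a box with one null side.\<close>

lemma (in product_sigma_finite) AE_PiM_finite_component:
  assumes "finite I" "i \<in> I" "AE x in M i. P x"
  shows "AE x in PiM I M. P (x i)"
proof -
  obtain N where N: "N \<in> null_sets (M i)" "{x\<in>space (M i). \<not> P x} \<subseteq> N"
    using assms(3) unfolding eventually_ae_filter by blast
  let ?A = "\<lambda>j. if j = i then N else space (M j)"
  have "emeasure (PiM I M) (Pi\<^sub>E I ?A) = (\<Prod>j\<in>I. emeasure (M j) (?A j))"
    using N assms by (intro emeasure_PiM) auto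
  \<comment> \<open>Other sides may have infinite measure, but 0 * \<infinity> = 0 in
    \<open>ennreal\<close>.\<close>
  also have "\<dots> = 0"
    using N assms by (intro prod_zero) auto
  finally have "Pi\<^sub>E I ?A \<in> null_sets (PiM I M)"
    using N assms by (intro null_setsI sets_PiM_I_finite) auto
  moreover have "{x\<in>space (PiM I M). \<not> P (x i)} \<subseteq> Pi\<^sub>E I ?A"
    using N(2) assms(2) by (force simp: space_PiM PiE_iff)
  ultimately show ?thesis
    by (rule AE_I')
qed

text \<open>Preimages under the two functions differ by a null set, which completeness makes
  measurable.\<close>

lemma (in complete_measure) measurable_cong_AE:
  assumes f: "f \<in> measurable M N" and g: "g \<in> space M \<rightarrow> space N"
    and ae: "AE x in M. f x = g x"
  shows "g \<in> measurable M N"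
proof (rule measurableI)
  fix A assume "A \<in> sets N"
  then have "f -` A \<inter> space M \<in> sets M"
    by (rule measurable_sets[OF f])
  moreover have "AE x in M. x \<in> f -` A \<inter> space M \<longleftrightarrow> x \<in> g -` A \<inter> space M"
    using ae by eventually_elim simp
  moreover have "g -` A \<inter> space M \<subseteq> space M" by simp
  ultimately show "g -` A \<inter> space M \<in> sets M"
    using in_sets_AE by iprover
qed (use g in auto)

section \<open>Broken geodesics along a chain\<close>

lemma prob_space_\<Gamma>_triv:
  assumes "geodesic_space TYPE('a::metric_space)" "x \<noteq> (y :: 'a)"
  shows "prob_space (\<Gamma>_triv x y)"
proof -
  obtain \<gamma> where \<gamma>: "minimising_path x y \<gamma>"
    using assms by (auto simp: geodesic_space_def)
  then have neq: "\<gamma> 0 \<noteq> \<gamma> 1"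
    using assms by (auto simp: minimising_path_def pathstart_def pathfinish_def)
  have "\<not> \<gamma> constant_on {0..1}"
  proof
    assume "\<gamma> constant_on {0..1}"
    then obtain c where "\<forall>t\<in>{0..1}. \<gamma> t = c"
      by (auto simp: constant_on_def)
    then have "\<gamma> 0 = c" "\<gamma> 1 = c" by simp_all
    then show False using neq by simp
  qed
  then have "geodesics x y \<noteq> {}"
    using \<gamma> by (auto simp: geodesics_def)
  then show ?thesis
    by (intro prob_spaceI) (simp add: space_\<Gamma>_triv emeasure_\<Gamma>_triv)
qed

text \<open>\<open>Len\<close> is constant in \<open>\<gamma>\<close>, and the factors along a
  proper chain are probability measures.\<close>

lemma chain_path_integral:
  assumes "geodesic_space TYPE('a::metric_space)" "(x :: nat \<Rightarrow> 'a) \<in> proper_chains n"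
  shows "(LINT \<gamma>|chain_path_measure \<Gamma>_triv n x. exp (- Len n x \<gamma>)) =
    (\<Prod>k=1..n. exp (- dist (x (k - 1)) (x k)))"
proof -
  have "prob_space (chain_path_measure \<Gamma>_triv n x)"
    unfolding chain_path_measure_def using assms
    by (intro prob_space_PiM prob_space_\<Gamma>_triv) (auto simp: proper_chains_def)
  then interpret prob_space "chain_path_measure \<Gamma>_triv n x" .
  show ?thesis
    by (simp add: Len_def prob_space exp_sum sum_negf[symmetric])
qed

section \<open>Integration over chains\<close>

lemma nn_integral_chain_exp_dist_via:
  fixes \<mu> :: "'a::metric_space measure" and n :: nat
  assumes "weight_measure \<mu>" "sigma_finite_measure \<mu>"
    and D: "countable D" "AE x in \<mu>. x \<in> closure D"
  shows "(\<integral>\<^sup>+ x. (\<Prod>k=1..n. exp_dist_via D (x (k - 1)) (x k)) \<partial>PiM {..n} (\<lambda>_. \<mu>)) =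
    emeasure \<mu> (space \<mu>)"
proof (induction n)
  interpret product_sigma_finite "\<lambda>_::nat. \<mu>"
    using assms(2) by (simp add: product_sigma_finite_def)
  case 0
  have "{..0::nat} = {0}" by auto
  then show ?case
    using product_nn_integral_singleton[of "\<lambda>_. 1" 0] by simp
next
  interpret product_sigma_finite "\<lambda>_::nat. \<mu>"
    using assms(2) by (simp add: product_sigma_finite_def)
  case (Suc n)
  have sets [measurable_cong]: "sets \<mu> = sets borel"
    using assms(1) by (simp add: weight_measure_def)
  note [measurable] = borel_measurable_exp_dist_via[OF D(1)]
  let ?g = "\<lambda>n x. \<Prod>k=1..n. exp_dist_via D (x (k - 1)) (x k)"
  have meas: "?g m \<in> borel_measurable (PiM {..m} (\<lambda>_. \<mu>))" for m :: nat
    by measurable (auto simp: le_diff_conv)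
  have "(\<integral>\<^sup>+ x. ?g (Suc n) x \<partial>PiM {..Suc n} (\<lambda>_. \<mu>)) =
      (\<integral>\<^sup>+ x. (\<integral>\<^sup>+ y. ?g (Suc n) (x(Suc n := y)) \<partial>\<mu>) \<partial>PiM {..n} (\<lambda>_. \<mu>))"
    using meas[of "Suc n"] unfolding atMost_Suc by (intro product_nn_integral_insert) auto
  also have "\<dots> = (\<integral>\<^sup>+ x. ?g n x * (\<integral>\<^sup>+ y. exp_dist_via D (x n) y \<partial>\<mu>) \<partial>PiM {..n} (\<lambda>_. \<mu>))"
  proof (intro nn_integral_cong)
    fix x :: "nat \<Rightarrow> 'a"
    \<comment> \<open>The new last point enters only the last factor, so the others leave the inner
      integral.\<close>
    have "?g n (x(Suc n := y)) = ?g n x" for y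
      by (intro prod.cong) auto
    then have "?g (Suc n) (x(Suc n := y)) = ?g n x * exp_dist_via D (x n) y" for y
      by simp
    then show "(\<integral>\<^sup>+ y. ?g (Suc n) (x(Suc n := y)) \<partial>\<mu>) = ?g n x * (\<integral>\<^sup>+ y. exp_dist_via D (x n) y \<partial>\<mu>)"
      by (simp add: nn_integral_cmult)
  qed
  also have "\<dots> = (\<integral>\<^sup>+ x. ?g n x \<partial>PiM {..n} (\<lambda>_. \<mu>))"
  proof (intro nn_integral_cong_AE)
    \<comment> \<open>Only the first argument must lie in the closure, so the weight equation
      applies with all \<open>y\<close> at once.\<close>
    have "AE x in PiM {..n} (\<lambda>_. \<mu>). x n \<in> closure D"
      using D(2) by (intro AE_PiM_finite_component) auto
    then show "AE x in PiM {..n} (\<lambda>_. \<mu>). ?g n x * (\<integral>\<^sup>+ y. exp_dist_via D (x n) y \<partial>\<mu>) = ?g n x"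
    proof eventually_elim
      case (elim x)
      then have "(\<integral>\<^sup>+ y. exp_dist_via D (x n) y \<partial>\<mu>) = 1"
        using assms(1) by (simp add: exp_dist_via_eq weight_measure_def dist_commute[of "x n"])
      then show ?case by simp
    qed
  qed
  finally show ?case
    using Suc by simp
qed

lemma chain_integral:
  fixes \<mu> :: "'a::metric_space measure"
  assumes "geodesic_space TYPE('a)" "weight_measure \<mu>" "radon_measure \<mu>"
    "no_mass_on_nonproper_chains \<mu>" "finite_measure \<mu>" "n > 0"
  shows "(LINT x:proper_chains n|chain_measure n \<mu>.
      (LINT \<gamma>|chain_path_measure \<Gamma>_triv n x. exp (- Len n x \<gamma>))) = measure \<mu> (space \<mu>)"
proof -
  interpret finite_measure \<mu> by fact
  interpret product_sigma_finite "\<lambda>_::nat. \<mu>"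
    by (simp add: product_sigma_finite_def sigma_finite_measure_axioms)
  have sets [measurable_cong]: "sets \<mu> = sets borel"
    using assms by (simp add: weight_measure_def)
  then have space: "space \<mu> = UNIV"
    using sets_eq_imp_space_eq[of \<mu> borel] by simp
  obtain D where D: "countable D" "AE x in \<mu>. x \<in> closure D"
    using radon_measure_AE_closure_countable assms by blast
  note [measurable] = borel_measurable_exp_dist_via[OF D(1)]
  let ?P = "PiM {..n} (\<lambda>_. \<mu>)"
  define f where "f x = indicator (proper_chains n) x *
    (LINT \<gamma>|chain_path_measure \<Gamma>_triv n x. exp (- Len n x \<gamma>))" for x :: "nat \<Rightarrow> 'a"
  define g where "g x = (\<Prod>k=1..n. exp_dist_via D (x (k - 1)) (x k))" for x :: "nat \<Rightarrow> 'a"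
  have g [measurable]: "g \<in> borel_measurable ?P"
    unfolding g_def by measurable (auto simp: le_diff_conv)
  \<comment> \<open>The hypothesis concerns the completed measure; \<open>AE_completion_iff\<close>
    below carries it to \<open>?P\<close>.\<close>
  have "AE x in completion ?P. x \<in> proper_chains n"
  proof -
    have "AE x in completion ?P. x \<notin> ({..n} \<rightarrow>\<^sub>E UNIV) - proper_chains n"
      using assms unfolding no_mass_on_nonproper_chains_def chain_measure_def by (intro AE_not_in) auto
    moreover have "AE x in completion ?P. x \<in> {..n} \<rightarrow>\<^sub>E UNIV"
      by (rule AE_I2) (simp add: space_PiM space)
    ultimately show ?thesis by eventually_elim auto
  qed
  moreover have "AE x in ?P. \<forall>k\<in>{..n}. x k \<in> closure D"
    using D(2) by (intro AE_finite_allI AE_PiM_finite_component) auto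
  ultimately have ae: "AE x in ?P. ennreal (f x) = g x"
    unfolding AE_completion_iff
  proof eventually_elim
    case (elim x)
    have "g x = (\<Prod>k=1..n. ennreal (exp (- dist (x (k - 1)) (x k))))"
      unfolding g_def using elim by (intro prod.cong exp_dist_via_eq) auto
    then show ?case
      using elim chain_path_integral[OF assms(1), of x n] by (simp add: f_def prod_ennreal)
  qed
  have f_nonneg: "f x \<ge> 0" for x
    unfolding f_def by (auto intro!: mult_nonneg_nonneg integral_nonneg)
  \<comment> \<open>This yields measurability of \<open>f\<close>; the Bochner integral of a
    non-measurable function would default to 0.\<close>
  have "AE x in completion ?P. enn2real (g x) = f x"
    using AE_completion[OF ae] by eventually_elim (metis enn2real_ennreal f_nonneg)
  then have f: "f \<in> borel_measurable (completion ?P)"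
    by (intro completion.measurable_cong_AE[OF measurable_completion[of "\<lambda>x. enn2real (g x)"]]) auto
  have "(\<integral>\<^sup>+ x. f x \<partial>completion ?P) = (\<integral>\<^sup>+ x. g x \<partial>?P)"
    unfolding nn_integral_completion using ae by (rule nn_integral_cong_AE)
  also have "\<dots> = emeasure \<mu> (space \<mu>)"
    unfolding g_def using assms(2) sigma_finite_measure_axioms D
    by (rule nn_integral_chain_exp_dist_via)
  finally show ?thesis
    using integral_eq_nn_integral[OF f] f_nonneg
    by (simp add: set_lebesgue_integral_def chain_measure_def f_def[abs_def] measure_def)
qed

theorem theorem5p3:
  fixes \<mu> :: "'a::metric_space measure"
  assumes "geodesic_space TYPE('a)"
    and "weight_measure \<mu>"
    and "radon_measure \<mu>"
    and "no_mass_on_nonproper_chains \<mu>"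
    and "emeasure \<mu> (space \<mu>) < \<infinity>"
  shows "(\<forall>N>0. Mag \<mu> \<Gamma>_triv N = (if even N then measure \<mu> (space \<mu>) else 0)) \<and>
    (\<lambda>N. Mag \<mu> \<Gamma>_triv (2 * N)) \<longlonglongrightarrow> measure \<mu> (space \<mu>)"
proof -
  have "finite_measure \<mu>"
    using assms(5) by (intro finite_measureI) auto
  note chain = chain_integral[OF assms(1-4) this]
  \<comment> \<open>The induction starts at \<open>N = 0\<close>, where the sum is empty; each
    further term switches between \<mu>(X) and 0.\<close>
  have Mag: "Mag \<mu> \<Gamma>_triv N = (if even N then measure \<mu> (space \<mu>) else 0)" for N
  proof (induction N)
    case (Suc N)
    then show ?case
      using chain[of "Suc N"] by (simp add: Mag_def split: if_splits)
  qed (simp add: Mag_def)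
  then show ?thesis by simp
qed

end
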